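(* Fix a real number $p>0$. For each $n=1,2,\dots$ let $X_1,\dots,X_n$ be independent random variables uniformly distributed on $[0,1]$, with ranks $R_1,\dots,R_n$ within the sample of size $n$, and let $\sigma_n$ be a random variable with range $\{1,\dots,n\}$ and arbitrary joint distribution with $X_1,\dots,X_n$. Then $$\limsup_{n\to\infty} \mathbb{E}\big[(R_{\sigma_n})^p\big]<\infty \quad\text{implies}\quad \limsup_{n\to\infty} n^p\,\mathbb{E}\big[(X_{\sigma_n})^p\big]<\infty .$$ In particular, if for each $n$ $\tau_n$ is a stopping time minimising $\mathbb{E}[(R_\tau)^p]$ over all stopping times $\tau$ with values in $\{1,\dots,n\}$ adapted to the natural filtration of $X_1,\dots,X_n$, then $$\limsup_{n\to\infty} n^p\,\mathbb{E}\big[(X_{\tau_n})^p\big]<\infty .$$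
   Context: For each $n$, let $Y_1<\dots<Y_n$ be the order statistics of the sample $X_1,\dots,X_n$ (the values are almost surely distinct). The rank $R_j$ of $X_j$ (which depends on $n$) is defined by $R_j=k$ on the event $\{X_j=Y_k\}$; so the smallest observation has rank $1$. $R_{\sigma_n}$ and $X_{\sigma_n}$ denote $R_j$ and $X_j$ evaluated at the random index $j=\sigma_n$. The index $\sigma_n$ need not be a stopping time; it may depend on the whole sample and on additional randomness. The natural filtration of $X_1,\dots,X_n$ is $\mathcal{F}_j=\sigma(X_1,\dots,X_j)$, $1\le j\le n$. *)

theory Defs
  imports "HOL-Probability.Probability"
begin

text \<open>
  A sample of size \<open>n\<close> is given by its values \<open>x 1, \<dots>, x n\<close>; the value of \<open>x\<close> at other
  indices is ignored.
\<close>

definition order_statistic :: "nat \<Rightarrow> (nat \<Rightarrow> real) \<Rightarrow> nat \<Rightarrow> real" where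
  "order_statistic n x k = sort (map x [1..<Suc n]) ! (k - 1)"

text \<open>
  For a sample with distinct values the index \<open>k\<close> below is unique. Ties form a null set for
  i.i.d. uniform samples; there \<open>LEAST\<close> picks the smallest possible rank.
\<close>

definition sample_rank :: "nat \<Rightarrow> (nat \<Rightarrow> real) \<Rightarrow> nat \<Rightarrow> nat" where
  "sample_rank n x j = (LEAST k. k \<in> {1..n} \<and> x j = order_statistic n x k)"

definition iid_uniform_sample :: "'a measure \<Rightarrow> (nat \<Rightarrow> 'a \<Rightarrow> real) \<Rightarrow> nat \<Rightarrow> bool" where
  "iid_uniform_sample M X n \<longleftrightarrow>
     prob_space M \<and>
     prob_space.indep_vars M (\<lambda>_. borel) X {1..n} \<and>
     (\<forall>j\<in>{1..n}. distr M borel (X j) = uniform_measure lborel {0..1})"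

definition natural_filtration :: "'a measure \<Rightarrow> (nat \<Rightarrow> 'a \<Rightarrow> real) \<Rightarrow> nat \<Rightarrow> 'a measure" where
  "natural_filtration M X j =
     sigma (space M) (\<Union>i\<in>{1..j}. sets (vimage_algebra (space M) (X i) borel))"

text \<open>
  The predicate \<open>stopping_time\<close> quantifies over all times \<open>t\<close>, but for \<open>T\<close> with values in
  \<open>{1..n}\<close> the condition is vacuous at \<open>t = 0\<close> and \<open>t \<ge> n\<close>, so that only
  \<open>X 1, \<dots>, X (n - 1)\<close> matter.
\<close>

definition sample_stopping_time ::
    "'a measure \<Rightarrow> (nat \<Rightarrow> 'a \<Rightarrow> real) \<Rightarrow> nat \<Rightarrow> ('a \<Rightarrow> nat) \<Rightarrow> bool" where
  "sample_stopping_time M X n T \<longleftrightarrow>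
     T \<in> space M \<rightarrow> {1..n} \<and> stopping_time (natural_filtration M X) T"

definition expected_rank_power ::
    "'a measure \<Rightarrow> (nat \<Rightarrow> 'a \<Rightarrow> real) \<Rightarrow> nat \<Rightarrow> real \<Rightarrow> ('a \<Rightarrow> nat) \<Rightarrow> real" where
  "expected_rank_power M X n p T =
     (\<integral>\<omega>. real (sample_rank n (\<lambda>j. X j \<omega>) (T \<omega>)) powr p \<partial>M)"

definition expected_value_power ::
    "'a measure \<Rightarrow> (nat \<Rightarrow> 'a \<Rightarrow> real) \<Rightarrow> real \<Rightarrow> ('a \<Rightarrow> nat) \<Rightarrow> real" where
  "expected_value_power M X p T = (\<integral>\<omega>. X (T \<omega>) \<omega> powr p \<partial>M)"

end

theory Submission
  imports Defs "HOL-Real_Asymp.Real_Asymp"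
begin

text \<open>
  If the value \<open>X\<^sub>\<sigma>\<close> exceeds \<open>4 R\<^sub>\<sigma> / n\<close> and \<open>m = \<lfloor>n X\<^sub>\<sigma>\<rfloor>\<close>, then the number \<open>N\<^sub>m\<close> of
  observations below \<open>m / n\<close> is smaller than \<open>(m + 1) / 4\<close>, although its mean is \<open>m\<close>. An exponential
  moment bound shows that the expected sum over all \<open>m\<close> of \<open>(m + 1)\<^sup>p\<close> on these events is bounded
  uniformly in \<open>n\<close>, whatever the dependence of \<open>\<sigma>\<close> on the sample.

  For optimal stopping times it remains to exhibit some stopping time whose rank has bounded \<open>p\<close>-th
  moment. Let \<open>q \<ge> p\<close> be an integer, \<open>a = q + 1\<close>, \<open>y\<^sub>j = n - j + 2 a\<close>, and stop at the first \<open>X\<^sub>j\<close> with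
  \<open>X\<^sub>j \<le> a / y\<^sub>j\<close>. Up to constants, index \<open>j\<close> is reached with probability at most \<open>(y\<^sub>j / y\<^sub>1)\<^sup>a\<close>,
  and the \<open>q\<close>-th moment of the rank is then at most \<open>(y\<^sub>1 / y\<^sub>j)\<^sup>q\<close>, so stopping at \<open>j\<close> contributes
  \<open>(y\<^sub>j / y\<^sub>1)\<^sup>a (a / y\<^sub>j) (y\<^sub>1 / y\<^sub>j)\<^sup>q = a / y\<^sub>1 \<le> a / n\<close>. Replacing the \<open>q\<close>-th power by an exponential
  with rate \<open>y\<^sub>j / y\<^sub>1\<close> makes the expectation factor by independence.
\<close>

section \<open>Ranks as counts of smaller observations\<close>

text \<open>In the sorted list the entries smaller than \<open>x j\<close> form an initial segment,
  of length \<open>m\<close>, and position \<open>m\<close> is the first one holding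
  \<open>x j\<close>. List positions start at 0 and ranks at 1, which gives \<open>Suc m\<close>.
  Ties do no harm, because \<open>LEAST\<close> selects this first position.\<close>

lemma sample_rank_eq_Suc_card:
  assumes "j \<in> {1..n}"
  shows "sample_rank n x j = Suc (card {i\<in>{1..n}. x i < x j})"
proof -
  define ys where "ys = sort (map x [1..<Suc n])"
  define m where "m = length (takeWhile (\<lambda>z. z < x j) ys)"
  have len: "length ys = n" and srt: "sorted ys"
    by (simp_all add: ys_def)
  have "x j \<in> set ys"
    using assms unfolding ys_def set_sort set_map by (intro imageI) auto
  then obtain l where l: "l < n" "ys ! l = x j"
    by (auto simp: in_set_conv_nth len)
  have below: "ys ! k < x j" if "k < m" for k
    using that nth_mem[of k "takeWhile (\<lambda>z. z < x j) ys"]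
    by (auto simp: m_def takeWhile_nth dest: set_takeWhileD)
  have "m \<le> l"
    using below[of l] l by force
  with l have "m < n" by simp
  have "\<not> ys ! m < x j"
    using nth_length_takeWhile[of "\<lambda>z. z < x j" ys] \<open>m < n\<close> by (simp add: m_def len)
  moreover have "ys ! m \<le> x j"
    using sorted_nth_mono[OF srt \<open>m \<le> l\<close>] l len by simp
  ultimately have at: "ys ! m = x j" by simp
  have "sample_rank n x j = Suc m"
    unfolding sample_rank_def order_statistic_def ys_def[symmetric]
  proof (rule Least_equality)
    show "Suc m \<in> {1..n} \<and> x j = ys ! (Suc m - 1)"
      using \<open>m < n\<close> at by simp
    show "Suc m \<le> k" if "k \<in> {1..n} \<and> x j = ys ! (k - 1)" for k
      using that below[of "k - 1"] by force
  qed
  also have "m = card {i\<in>{1..n}. x i < x j}"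
  proof -
    have *: "\<And>k. k < n \<Longrightarrow> ys ! k < x j \<longleftrightarrow> k < m"
      using below sorted_nth_mono[OF srt] at len by (metis not_less)
    have "m = card {k. k < n \<and> k < m}"
      using \<open>m < n\<close> by (subst Collect_cong[of _ "\<lambda>k. k < m"]) auto
    also have "{k. k < n \<and> k < m} = {k. k < length ys \<and> ys ! k < x j}"
      using * len by auto
    also have "card \<dots> = length (filter (\<lambda>z. z < x j) ys)"
      by (simp add: length_filter_conv_card)
    also have "\<dots> = length (filter (\<lambda>z. z < x j) (map x [1..<Suc n]))"
      unfolding ys_def by (metis mset_filter mset_sort size_mset)
    also have "\<dots> = length (filter (\<lambda>i. x i < x j) [1..<Suc n])"
      by (simp add: filter_map comp_def)
    also have "\<dots> = card (set (filter (\<lambda>i. x i < x j) [1..<Suc n]))"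
      by (intro distinct_card[symmetric]) simp
    also have "set (filter (\<lambda>i. x i < x j) [1..<Suc n]) = {i\<in>{1..n}. x i < x j}"
      by auto
    finally show ?thesis .
  qed
  finally show ?thesis by simp
qed

lemma sample_rank_bounds:
  assumes "j \<in> {1..n}"
  shows "1 \<le> sample_rank n x j" "sample_rank n x j \<le> n"
proof -
  have "card {i\<in>{1..n}. x i < x j} \<le> card ({1..n} - {j})"
    by (rule card_mono) auto
  also have "\<dots> < n"
    using assms by simp
  finally show "1 \<le> sample_rank n x j" "sample_rank n x j \<le> n"
    by (simp_all add: sample_rank_eq_Suc_card[OF assms])
qed

text \<open>The additive form turns an exponential of a count into a product with one factor per
  observation, to which independence applies.\<close>

lemma real_card_less_eq_sum_indicator:
  "real (card {i\<in>{1..n}. x i < t}) = (\<Sum>i\<in>{1..n}. indicator {..<t} (x i))"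
  for t :: real and n :: nat
proof -
  have "real (card {i\<in>{1..n}. x i < t}) = (\<Sum>i\<in>{i\<in>{1..n}. x i < t}. 1)" by simp
  also have "\<dots> = (\<Sum>i\<in>{1..n}. if x i < t then 1 else 0)" by (rule sum.inter_filter) simp
  finally show ?thesis by (simp add: indicator_def of_bool_def)
qed

text \<open>Being affine in the indicator, the exponential has an expectation that depends only on
  the probability of \<open>A\<close>.\<close>

lemma exp_times_indicator: "exp (s * indicator A x) = 1 + (exp s - 1) * indicator A x" for s :: real
  by (simp add: indicator_def)

section \<open>Expectations, independence and measurability for a uniform sample\<close>

locale uniform_sample = prob_space M for M :: "'a measure" +
  fixes X :: "nat \<Rightarrow> 'a \<Rightarrow> real" and n :: nat
  assumes sample: "iid_uniform_sample M X n"
begin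

lemma indep_X: "indep_vars (\<lambda>_. borel) X {1..n}"
  and distr_X: "j \<in> {1..n} \<Longrightarrow> distr M borel (X j) = uniform_measure lborel {0..1}"
  using sample by (auto simp: iid_uniform_sample_def)

lemma measurable_X: "j \<in> {1..n} \<Longrightarrow> X j \<in> borel_measurable M"
  using indep_X by (auto simp: indep_vars_def)

lemma expectation_indicator:
  assumes "j \<in> {1..n}" "A \<in> sets borel"
  shows "expectation (\<lambda>\<omega>. indicator A (X j \<omega>)) = measure lborel ({0..1} \<inter> A)"
proof -
  have "expectation (\<lambda>\<omega>. indicator A (X j \<omega>)) = (\<integral>x. (indicator A x :: real) \<partial>distr M borel (X j))"
    using assms by (subst integral_distr) (auto intro: measurable_X)
  also have "\<dots> = measure lborel ({0..1} \<inter> A)"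
    using assms by (simp add: distr_X)
  finally show ?thesis .
qed

lemma integrable_indicator_X:
  assumes "j \<in> {1..n}" "A \<in> sets borel"
  shows "integrable M (\<lambda>\<omega>. indicator A (X j \<omega>) :: real)"
proof (rule integrable_const_bound[where B = 1])
  show "(\<lambda>\<omega>. indicator A (X j \<omega>) :: real) \<in> borel_measurable M"
    using measurable_X[OF assms(1)] assms(2) by measurable
qed auto

lemma
  assumes "j \<in> {1..n}" "0 \<le> c" "c \<le> 1"
  shows expectation_lessThan: "expectation (\<lambda>\<omega>. indicator {..<c} (X j \<omega>)) = c"
    and expectation_atMost: "expectation (\<lambda>\<omega>. indicator {..c} (X j \<omega>)) = c"
    and expectation_greaterThan: "expectation (\<lambda>\<omega>. indicator {c<..} (X j \<omega>)) = 1 - c"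
proof -
  have "{0..1} \<inter> {..<c} = {0..<c}" "{0..1} \<inter> {..c} = {0..c}" "{0..1} \<inter> {c<..} = {c<..1}"
    using assms by auto
  then show "expectation (\<lambda>\<omega>. indicator {..<c} (X j \<omega>)) = c"
    "expectation (\<lambda>\<omega>. indicator {..c} (X j \<omega>)) = c"
    "expectation (\<lambda>\<omega>. indicator {c<..} (X j \<omega>)) = 1 - c"
    using assms by (simp_all add: expectation_indicator)
qed

lemma AE_X_unit_interval: "AE \<omega> in M. \<forall>j\<in>{1..n}. X j \<omega> \<in> {0..1}"
proof (rule AE_finite_allI)
  fix j assume j: "j \<in> {1..n}"
  have "AE x in distr M borel (X j). x \<in> {0..1}"
    unfolding distr_X[OF j] by (rule AE_uniform_measureI) auto
  then show "AE \<omega> in M. X j \<omega> \<in> {0..1}"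
    by (subst (asm) AE_distr_iff) (use measurable_X[OF j] in auto)
qed simp

lemma
  fixes f :: "nat \<Rightarrow> real \<Rightarrow> real"
  assumes "\<And>i. i \<in> {1..n} \<Longrightarrow> f i \<in> borel_measurable borel"
    and "\<And>i x. i \<in> {1..n} \<Longrightarrow> \<bar>f i x\<bar> \<le> B"
  shows expectation_prod:
      "expectation (\<lambda>\<omega>. \<Prod>i\<in>{1..n}. f i (X i \<omega>)) = (\<Prod>i\<in>{1..n}. expectation (\<lambda>\<omega>. f i (X i \<omega>)))"
    and integrable_prod: "integrable M (\<lambda>\<omega>. \<Prod>i\<in>{1..n}. f i (X i \<omega>))"
proof -
  have indep: "indep_vars (\<lambda>_. borel) (\<lambda>i \<omega>. f i (X i \<omega>)) {1..n}"
    using assms by (intro indep_vars_compose2[OF indep_X]) auto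
  have int: "integrable M (\<lambda>\<omega>. f i (X i \<omega>))" if "i \<in> {1..n}" for i
    using that assms
    by (intro integrable_const_bound[where B = B] measurable_compose[OF measurable_X]) auto
  show "expectation (\<lambda>\<omega>. \<Prod>i\<in>{1..n}. f i (X i \<omega>)) = (\<Prod>i\<in>{1..n}. expectation (\<lambda>\<omega>. f i (X i \<omega>)))"
    by (rule indep_vars_lebesgue_integral) (use indep int in auto)
  show "integrable M (\<lambda>\<omega>. \<Prod>i\<in>{1..n}. f i (X i \<omega>))"
    by (rule indep_vars_integrable) (use indep int in auto)
qed

text \<open>The random index takes finitely many values, so it suffices to treat a fixed
  \<open>j\<close>, where the rank is one plus a finite sum of indicators of comparisons.\<close>

lemma measurable_sample_rank:
  assumes T: "T \<in> measurable M (count_space {1..n})"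
  shows "(\<lambda>\<omega>. real (sample_rank n (\<lambda>j. X j \<omega>) (T \<omega>))) \<in> borel_measurable M"
proof (rule measurable_compose_countable'[OF _ T])
  fix j assume j: "j \<in> {1..n}"
  have [measurable]: "X i \<in> borel_measurable M" if "i \<in> {1..n}" for i
    by (rule measurable_X[OF that])
  have [measurable]: "X j \<in> borel_measurable M" by (rule measurable_X[OF j])
  have "(\<lambda>\<omega>. 1 + (\<Sum>i\<in>{1..n}. if X i \<omega> < X j \<omega> then 1 else 0 :: real)) \<in> borel_measurable M"
    by measurable
  moreover have "real (sample_rank n (\<lambda>j. X j \<omega>) j) =
      1 + (\<Sum>i\<in>{1..n}. if X i \<omega> < X j \<omega> then 1 else 0)" for \<omega>
    unfolding sample_rank_eq_Suc_card[OF j] of_nat_Suc real_card_less_eq_sum_indicator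
    by (simp add: indicator_def of_bool_def)
  ultimately show "(\<lambda>\<omega>. real (sample_rank n (\<lambda>j. X j \<omega>) j)) \<in> borel_measurable M"
    by simp
qed simp

text \<open>Ranks never exceed \<open>n\<close>. Integrability matters because the Bochner integral
  of a non-integrable function is 0 by convention, and monotonicity of the integral would then
  fail.\<close>

lemma integrable_rank_power:
  assumes T: "T \<in> measurable M (count_space {1..n})"  and "p > 0"
  shows "integrable M (\<lambda>\<omega>. real (sample_rank n (\<lambda>j. X j \<omega>) (T \<omega>)) powr p)"
proof (rule integrable_const_bound[where B = "real n powr p"])
  show "AE \<omega> in M. norm (real (sample_rank n (\<lambda>j. X j \<omega>) (T \<omega>)) powr p) \<le> real n powr p"
  proof (rule AE_I2)
    fix \<omega> assume "\<omega> \<in> space M"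
    then have "T \<omega> \<in> {1..n}" using measurable_space[OF T] by simp
    then show "norm (real (sample_rank n (\<lambda>j. X j \<omega>) (T \<omega>)) powr p) \<le> real n powr p"
      using sample_rank_bounds[of "T \<omega>" n] \<open>p > 0\<close> by (simp add: powr_mono2)
  qed
qed (use measurable_sample_rank[OF T] in measurable)

end

section \<open>Lower deviations of counts and the value bound for an arbitrary index\<close>

text \<open>The exponent equals \<open>1/4 - m/4\<close>, so exponential decay beats the polynomial
  factor. The term \<open>(m + 1) / 4\<close> is the deviation level and \<open>- m / 2\<close>
  comes from the exponential moment of the count.\<close>

lemma summable_deviation_series:
  "summable (\<lambda>m::nat. (real m + 1) powr p * exp ((real m + 1) / 4 - real m / 2))"
proof (rule summable_comparison_test_bigo)
  show "summable (\<lambda>m::nat. norm (1 / real m ^ 2))"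
    using inverse_power_summable[of 2, where 'a = real] by (simp add: inverse_eq_divide)
  show "(\<lambda>m::nat. (real m + 1) powr p * exp ((real m + 1) / 4 - real m / 2)) \<in> O(\<lambda>m. 1 / real m ^ 2)"
    by real_asymp
qed

text \<open>This is a deterministic inequality, hence it may be applied at an index that depends on
  the sample in any way. The exponential is at least 1 when the count is at most
  \<open>(m + 1) / 4\<close>; summing over all \<open>m\<close> covers the relevant one, which is
  random.\<close>

lemma value_power_le_rank_power:
  fixes x :: "nat \<Rightarrow> real"
  assumes "p > 0" "j \<in> {1..n}" "x j \<in> {0..1}"
  shows "(real n * x j) powr p \<le> 4 powr p * real (sample_rank n x j) powr p +
    (\<Sum>m\<le>n. (real m + 1) powr p * exp ((real m + 1) / 4 - real (card {i\<in>{1..n}. x i < real m / real n})))"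
    (is "_ \<le> ?A + (\<Sum>m\<le>n. ?g m)")
proof (cases "real n * x j \<le> 4 * real (sample_rank n x j)")
  case True
  have "(real n * x j) powr p \<le> (4 * real (sample_rank n x j)) powr p"
    using assms True by (intro powr_mono2) auto
  also have "\<dots> = ?A" by (simp add: powr_mult)
  finally show ?thesis
    using sum_nonneg[of "{..n}" ?g] by simp
next
  case False
  define m where "m = nat \<lfloor>real n * x j\<rfloor>"
  have n: "real n > 0" using assms by simp
  have m: "real m \<le> real n * x j" "real n * x j < real m + 1"
    using assms by (simp_all add: m_def)
  have "real n * x j \<le> real n" using assms by (simp add: mult_left_le)
  then have "m \<le> n" using m by linarith
  have "real m / real n \<le> x j" using m n by (simp add: field_simps)
  then have "card {i\<in>{1..n}. x i < real m / real n} \<le> card {i\<in>{1..n}. x i < x j}"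
    by (intro card_mono) auto
  \<comment> \<open>The count is at most the rank minus 1, and in this case the rank is below
    \<open>n * x j / 4\<close>, hence below \<open>(m + 1) / 4\<close>.\<close>
  then have "real (card {i\<in>{1..n}. x i < real m / real n}) \<le> (real m + 1) / 4"
    using False m by (simp add: sample_rank_eq_Suc_card[OF assms(2)])
  then have "1 \<le> exp ((real m + 1) / 4 - real (card {i\<in>{1..n}. x i < real m / real n}))"
    by simp
  moreover have "(real n * x j) powr p \<le> (real m + 1) powr p"
    using assms m by (intro powr_mono2) auto
  ultimately have "(real n * x j) powr p * 1 \<le> ?g m"
    by (intro mult_mono) auto
  also have "\<dots> \<le> (\<Sum>m\<le>n. ?g m)"
    using \<open>m \<le> n\<close> by (intro member_le_sum) auto
  finally show ?thesis by (simp add: add_increasing)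
qed

context uniform_sample
begin

lemma
  assumes "m \<le> n" "n \<ge> 1"
  shows integrable_exp_neg_count:
      "integrable M (\<lambda>\<omega>. exp (- real (card {i\<in>{1..n}. X i \<omega> < real m / real n})))"
    and expectation_exp_neg_count_le:
      "expectation (\<lambda>\<omega>. exp (- real (card {i\<in>{1..n}. X i \<omega> < real m / real n}))) \<le> exp (- real m / 2)"
proof -
  define c where "c = real m / real n"
  have c: "0 \<le> c" "c \<le> 1" using assms by (auto simp: c_def)
  define f where "f = (\<lambda>x. exp (- 1 * indicator {..<c} x) :: real)"
  have eq: "exp (- real (card {i\<in>{1..n}. X i \<omega> < c})) = (\<Prod>i\<in>{1..n}. f (X i \<omega>))" for \<omega>
    unfolding real_card_less_eq_sum_indicator by (simp add: f_def exp_sum flip: sum_negf)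
  have meas: "f \<in> borel_measurable borel" by (simp add: f_def)
  have bd: "\<bar>f x\<bar> \<le> 1" for x by (simp add: f_def)
  show "integrable M (\<lambda>\<omega>. exp (- real (card {i\<in>{1..n}. X i \<omega> < real m / real n})))"
    unfolding c_def[symmetric] eq by (rule integrable_prod[OF meas bd])
  \<comment> \<open>This crude bound yields decay rate 1/2 in \<open>m\<close>, which still exceeds
    the rate 1/4 of the growing factor \<open>exp ((m + 1) / 4)\<close>.\<close>
  have e: "exp (- 1 :: real) \<le> 1 / 2"
    using exp_ge_add_one_self[of 1] by (simp add: exp_minus field_simps)
  have "expectation (\<lambda>\<omega>. f (X i \<omega>)) \<le> exp (- c / 2)" if "i \<in> {1..n}" for i
  proof -
    have "expectation (\<lambda>\<omega>. f (X i \<omega>)) = 1 + (exp (- 1) - 1) * c"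
      unfolding f_def exp_times_indicator
      using that c by (simp add: integrable_indicator_X expectation_lessThan prob_space)
    also have "\<dots> \<le> 1 + (- c / 2)"
      using mult_right_mono[OF e c(1)] by (simp add: algebra_simps)
    also have "\<dots> \<le> exp (- c / 2)" by (rule exp_ge_add_one_self)
    finally show ?thesis .
  qed
  then have "(\<Prod>i\<in>{1..n}. expectation (\<lambda>\<omega>. f (X i \<omega>))) \<le> (\<Prod>i\<in>{1..n}. exp (- c / 2))"
    by (intro prod_mono) (auto simp: f_def)
  also have "\<dots> = exp (- real m / 2)"
    using assms by (simp add: c_def flip: exp_of_nat_mult)
  finally show "expectation (\<lambda>\<omega>. exp (- real (card {i\<in>{1..n}. X i \<omega> < real m / real n}))) \<le> exp (- real m / 2)"
    unfolding c_def[symmetric] eq expectation_prod[OF meas bd] .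
qed

text \<open>The pathwise inequality is integrated at the index \<open>T\<close>; by linearity the
  joint law of \<open>T\<close> and the sample enters only through the rank term. The finite sum is
  then dominated by a series that does not depend on \<open>n\<close>.\<close>

lemma expected_value_power_le:
  assumes "p > 0" "n \<ge> 1" and T: "T \<in> measurable M (count_space {1..n})"
  shows "real n powr p * expected_value_power M X p T \<le> 4 powr p * expected_rank_power M X n p T +
    (\<Sum>m. (real m + 1) powr p * exp ((real m + 1) / 4 - real m / 2))"
proof -
  define N where "N = (\<lambda>m \<omega>. real (card {i\<in>{1..n}. X i \<omega> < real m / real n}))"
  have T_in: "T \<omega> \<in> {1..n}" if "\<omega> \<in> space M" for \<omega>
    using measurable_space[OF T that] by simp
  have XT: "AE \<omega> in M. T \<omega> \<in> {1..n} \<and> X (T \<omega>) \<omega> \<in> {0..1}"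
    using AE_X_unit_interval AE_space by eventually_elim (use T_in in blast)
  have meas: "(\<lambda>\<omega>. X (T \<omega>) \<omega>) \<in> borel_measurable M"
    by (rule measurable_compose_countable'[OF measurable_X T]) auto
  have intg: "integrable M (\<lambda>\<omega>. X (T \<omega>) \<omega> powr p)"
  proof (rule integrable_const_bound[where B = 1])
    show "AE \<omega> in M. norm (X (T \<omega>) \<omega> powr p) \<le> 1"
      using XT by eventually_elim (use \<open>p > 0\<close> powr_mono2[of p _ 1] in auto)
  qed (use meas in measurable)
  have intN: "integrable M (\<lambda>\<omega>. exp (- N m \<omega>))"
    and leN: "expectation (\<lambda>\<omega>. exp (- N m \<omega>)) \<le> exp (- real m / 2)" if "m \<le> n" for m
    unfolding N_def using that assms
    by (intro integrable_exp_neg_count expectation_exp_neg_count_le; simp)+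
  have intR: "integrable M (\<lambda>\<omega>. 4 powr p * real (sample_rank n (\<lambda>j. X j \<omega>) (T \<omega>)) powr p)"
    by (rule integrable_mult_right, rule integrable_rank_power[OF T \<open>p > 0\<close>])
  \<comment> \<open>The deterministic weights are separated, so that only
    \<open>exp (- N m \<omega>)\<close> is random in each summand.\<close>
  define w where "w = (\<lambda>m::nat. (real m + 1) powr p * exp ((real m + 1) / 4))"
  have intS: "integrable M (\<lambda>\<omega>. \<Sum>m\<le>n. w m * exp (- N m \<omega>))"
    by (rule Bochner_Integration.integrable_sum, rule integrable_mult_right, rule intN) simp
  have exp_diff': "exp (a - b) = exp a * exp (- b)" for a b :: real
    by (simp add: mult_exp_exp)
  have "real n powr p * expected_value_power M X p T = expectation (\<lambda>\<omega>. real n powr p * X (T \<omega>) \<omega> powr p)"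
    by (simp add: expected_value_power_def)
  also have "\<dots> \<le> expectation (\<lambda>\<omega>. 4 powr p * real (sample_rank n (\<lambda>j. X j \<omega>) (T \<omega>)) powr p +
    (\<Sum>m\<le>n. w m * exp (- N m \<omega>)))"
  proof (rule integral_mono_AE)
    show "AE \<omega> in M. real n powr p * X (T \<omega>) \<omega> powr p \<le>
        4 powr p * real (sample_rank n (\<lambda>j. X j \<omega>) (T \<omega>)) powr p + (\<Sum>m\<le>n. w m * exp (- N m \<omega>))"
      using XT
    proof eventually_elim
      case (elim \<omega>)
      with value_power_le_rank_power[of p "T \<omega>" n "\<lambda>j. X j \<omega>"] \<open>p > 0\<close> show ?case
        by (simp add: powr_mult w_def N_def exp_diff' mult.assoc)
    qed
  qed (use intg intR intS in auto)
  also have "\<dots> = 4 powr p * expected_rank_power M X n p T + (\<Sum>m\<le>n. w m * expectation (\<lambda>\<omega>. exp (- N m \<omega>)))"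
    by (subst Bochner_Integration.integral_add[OF intR intS], subst Bochner_Integration.integral_sum)
      (simp_all add: expected_rank_power_def intN)
  also have "(\<Sum>m\<le>n. w m * expectation (\<lambda>\<omega>. exp (- N m \<omega>))) \<le> (\<Sum>m\<le>n. w m * exp (- real m / 2))"
    by (intro sum_mono mult_left_mono leN) (auto simp: w_def)
  also have "\<dots> = (\<Sum>m\<le>n. (real m + 1) powr p * exp ((real m + 1) / 4 - real m / 2))"
    by (simp add: w_def exp_diff' mult.assoc)
  also have "\<dots> \<le> (\<Sum>m. (real m + 1) powr p * exp ((real m + 1) / 4 - real m / 2))"
    by (intro sum_le_suminf summable_deviation_series) auto
  finally show ?thesis by simp
qed

end

section \<open>Analytic estimates for the threshold rule\<close>

text \<open>A single term of the exponential series of \<open>s * x\<close> is at most the whole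
  series. This trades a moment for an exponential moment at the price
  \<open>fact q / s ^ q\<close>.\<close>

lemma power_le_fact_mult_exp:
  fixes s x :: real
  assumes "0 < s" "0 \<le> x"
  shows "x ^ q \<le> fact q / s ^ q * exp (s * x)"
proof -
  have "(\<Sum>k\<in>{q}. (s * x) ^ k /\<^sub>R fact k) \<le> exp (s * x)"
    using assms unfolding exp_def
    by (intro sum_le_suminf summable_exp_generic) auto
  then show ?thesis
    using assms by (simp add: field_simps power_mult_distrib)
qed

lemma exp_minus_one_le_double:
  fixes s :: real
  assumes "0 \<le> s" "s \<le> 1"
  shows "exp s - 1 \<le> 2 * s"
  using exp_bound[of s] assms mult_left_le[of s s] by (simp add: power2_eq_square)

text \<open>With \<open>y = n - i + b\<close>, Bernoulli's inequality gives
  \<open>1 - a / y \<le> ((y - 1) / y) ^ a\<close>, and the product of these powers telescopes. The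
  condition \<open>a \<le> b\<close> keeps all factors nonnegative.\<close>

lemma prod_one_minus_divide_le_power:
  fixes b :: real
  assumes "b \<ge> 1" "real a \<le> b" "1 \<le> j" "j \<le> n"
  shows "(\<Prod>i\<in>{1..<j}. 1 - real a / (real n - real i + b)) \<le>
    ((real n - real j + b) / (real n - 1 + b)) ^ a"
  using assms(3,4)
proof (induction j rule: dec_induct)
  case base
  show ?case using assms by simp
next
  case (step j)
  define y where "y = real n - real j + b"
  have y: "y > 1" using step assms by (simp add: y_def)
  have "1 - real a / y \<le> (1 - 1 / y) ^ a"
    using Bernoulli_inequality[of "- 1 / y" a] y by simp
  moreover have "0 \<le> (\<Prod>i\<in>{1..<j}. 1 - real a / (real n - real i + b))"
    using step assms(2) y by (intro prod_nonneg) (auto simp: y_def field_simps)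
  moreover have "(\<Prod>i\<in>{1..<j}. 1 - real a / (real n - real i + b)) \<le> (y / (real n - 1 + b)) ^ a"
    using step by (simp add: y_def)
  ultimately have "(1 - real a / y) * (\<Prod>i\<in>{1..<j}. 1 - real a / (real n - real i + b))
     \<le> (1 - 1 / y) ^ a * (y / (real n - 1 + b)) ^ a"
    using y by (intro mult_mono) auto
  also have "\<dots> = ((1 - 1 / y) * (y / (real n - 1 + b))) ^ a"
    by (simp only: power_mult_distrib)
  also have "(1 - 1 / y) * (y / (real n - 1 + b)) = (y - 1) / (real n - 1 + b)"
    using y by (simp add: left_diff_distrib diff_divide_distrib)
  also have "y - 1 = real n - real (Suc j) + b"
    by (simp add: y_def)
  finally show ?case
    using step by (simp add: y_def mult.commute)
qed

section \<open>Exponential moments on the event of reaching a given time\<close>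

text \<open>Encodes, coordinate by coordinate, that the threshold rule rejects everything before
  time \<open>j\<close> and that observation \<open>j\<close> lies in \<open>D\<close>. Stopping
  below the threshold is \<open>D = {..c j}\<close>; the forced stop at the last time is
  \<open>D = UNIV\<close>.\<close>

definition continuation_region :: "(nat \<Rightarrow> real) \<Rightarrow> nat \<Rightarrow> real set \<Rightarrow> nat \<Rightarrow> real set" where
  "continuation_region c j D i = (if i < j then {c i<..} else if i = j then D else UNIV)"

context uniform_sample
begin

lemma
  fixes D :: "real set"
  assumes "j \<in> {1..n}" "\<And>i. i \<in> {1..n} \<Longrightarrow> 0 \<le> c i \<and> c i \<le> 1 / 2"
    and "0 \<le> s" "s \<le> 1" "0 \<le> u" "u \<le> 1" "D \<in> sets borel"
  shows integrable_continuation: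
      "integrable M (\<lambda>\<omega>. \<Prod>i\<in>{1..n}. indicator (continuation_region c j D i) (X i \<omega>) *
         exp (s * indicator {..<u} (X i \<omega>)) :: real)"
    and expectation_continuation_le:
      "expectation (\<lambda>\<omega>. \<Prod>i\<in>{1..n}. indicator (continuation_region c j D i) (X i \<omega>) *
         exp (s * indicator {..<u} (X i \<omega>)))
       \<le> exp 1 * exp (4 * s * u) ^ n * expectation (\<lambda>\<omega>. indicator D (X j \<omega>)) * (\<Prod>i\<in>{1..<j}. 1 - c i)"
proof -
  define f :: "nat \<Rightarrow> real \<Rightarrow> real" where
    "f = (\<lambda>i x. indicator (continuation_region c j D i) x * exp (s * indicator {..<u} x))"
  define d :: real where "d = expectation (\<lambda>\<omega>. indicator D (X j \<omega>))"
  define v where "v = exp (4 * s * u)"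
  have "continuation_region c j D i \<in> sets borel" for i
    using assms by (simp add: continuation_region_def)
  then have meas: "f i \<in> borel_measurable borel" for i
    unfolding f_def by measurable
  have exp_le: "exp (s * indicator {..<u} x) \<le> exp 1" for x
    using assms by (simp add: indicator_def)
  have bd: "\<bar>f i x\<bar> \<le> exp 1" for i x
    using exp_le[of x] by (simp add: f_def indicator_def)
  show "integrable M (\<lambda>\<omega>. \<Prod>i\<in>{1..n}. indicator (continuation_region c j D i) (X i \<omega>) *
         exp (s * indicator {..<u} (X i \<omega>)) :: real)"
    using integrable_prod[of f, OF meas bd] by (simp add: f_def)
  have int_f: "integrable M (\<lambda>\<omega>. f i (X i \<omega>))" if "i \<in> {1..n}" for i
    by (rule integrable_const_bound[of _ "exp 1"])
      (use bd meas in \<open>auto intro!: measurable_compose[OF measurable_X[OF that]]\<close>)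
  have su: "(exp s - 1) * u \<le> 2 * s * u"
    using exp_minus_one_le_double[of s] assms by (intro mult_right_mono) auto
  have v1: "1 + 4 * s * u \<le> v"
    unfolding v_def by (rule exp_ge_add_one_self)
  have su0: "0 \<le> s * u" using assms by simp
  have d0: "0 \<le> d" unfolding d_def by simp
  have int_ind: "integrable M (\<lambda>\<omega>. indicator A (X i \<omega>) :: real)" if "i \<in> {1..n}" "A \<in> sets borel" for i A
    using that by (rule integrable_indicator_X)
  have factor: "expectation (\<lambda>\<omega>. f i (X i \<omega>)) \<le> (if i < j then 1 - c i else if i = j then exp 1 * d else 1) * v"
    if i: "i \<in> {1..n}" for i
  proof -
    consider "i < j" | "i = j" | "i > j" by linarith
    then show ?thesis
    proof cases
      case 1
      \<comment> \<open>The weight is split into 1 and its excess \<open>exp s - 1\<close> on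
        \<open>{..<u}\<close>; for the excess the restriction to rejected values is dropped.\<close>
      have "expectation (\<lambda>\<omega>. f i (X i \<omega>)) \<le>
          expectation (\<lambda>\<omega>. indicator {c i<..} (X i \<omega>) + (exp s - 1) * indicator {..<u} (X i \<omega>))"
      proof (rule integral_mono)
        show "integrable M (\<lambda>\<omega>. indicator {c i<..} (X i \<omega>) + (exp s - 1) * indicator {..<u} (X i \<omega>))"
          using i by (intro Bochner_Integration.integrable_add integrable_mult_right int_ind) auto
      qed (use 1 assms int_f[OF i] in \<open>auto simp: f_def continuation_region_def indicator_def\<close>)
      also have "\<dots> = (1 - c i) + (exp s - 1) * u"
        using expectation_greaterThan[OF i, of "c i"] assms(2)[OF i] assms i
        by (simp add: int_ind expectation_lessThan)
      also have "\<dots> \<le> (1 - c i) + 2 * s * u" using su by simp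
      \<comment> \<open>Since \<open>1 - c i\<close> is at least 1/2, the additive error
        \<open>2 * s * u\<close> can be absorbed into a multiplicative one. This is the reason for
        the bound 1/2 on the thresholds.\<close>
      also have "\<dots> \<le> (1 - c i) * (1 + 4 * s * u)"
        using assms(2)[OF i] mult_right_mono[of "1 / 2" "1 - c i" "4 * (s * u)"] su0
        by (simp add: algebra_simps)
      also have "\<dots> \<le> (1 - c i) * v"
        using assms(2)[OF i] v1 by (intro mult_left_mono) auto
      finally show ?thesis using 1 by simp
    next
      case 2
      have "expectation (\<lambda>\<omega>. f i (X i \<omega>)) \<le> expectation (\<lambda>\<omega>. exp 1 * indicator D (X i \<omega>))"
        using 2 exp_le assms by (intro integral_mono int_f i integrable_mult_right int_ind)
          (auto simp: f_def continuation_region_def indicator_def)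
      also have "\<dots> = exp 1 * d" using 2 by (simp add: d_def)
      \<comment> \<open>The factor \<open>v\<close>, which is at least 1, is inserted so that all
        \<open>n\<close> coordinates carry the same one and together give
        \<open>v ^ n\<close>.\<close>
      also have "\<dots> \<le> exp 1 * d * v"
        using v1 su0 d0 mult_left_mono[of 1 v "exp 1 * d"] by simp
      finally show ?thesis using 2 by simp
    next
      case 3
      have "expectation (\<lambda>\<omega>. f i (X i \<omega>)) = expectation (\<lambda>\<omega>. 1 + (exp s - 1) * indicator {..<u} (X i \<omega>))"
        using 3 by (simp add: f_def continuation_region_def exp_times_indicator)
      also have "\<dots> = 1 + (exp s - 1) * u"
        using assms i by (simp add: int_ind expectation_lessThan prob_space)
      finally show ?thesis using 3 su v1 su0 by simp
    qed
  qed
  have "expectation (\<lambda>\<omega>. \<Prod>i\<in>{1..n}. f i (X i \<omega>)) = (\<Prod>i\<in>{1..n}. expectation (\<lambda>\<omega>. f i (X i \<omega>)))"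
    by (rule expectation_prod[of f, OF meas bd])
  also have "\<dots> \<le> (\<Prod>i\<in>{1..n}. (if i < j then 1 - c i else if i = j then exp 1 * d else 1) * v)"
    using factor by (intro prod_mono) (auto simp: f_def)
  also have "\<dots> = (\<Prod>i\<in>{1..n}. if i < j then 1 - c i else if i = j then exp 1 * d else 1) * v ^ n"
    by (simp add: prod.distrib)
  also have "(\<Prod>i\<in>{1..n}. if i < j then 1 - c i else if i = j then exp 1 * d else 1) =
      (\<Prod>i\<in>insert j {1..<j}. if i < j then 1 - c i else if i = j then exp 1 * d else 1)"
    using assms(1) by (intro prod.mono_neutral_right) auto
  also have "\<dots> = exp 1 * d * (\<Prod>i\<in>{1..<j}. 1 - c i)"
    by simp
  finally show "expectation (\<lambda>\<omega>. \<Prod>i\<in>{1..n}. indicator (continuation_region c j D i) (X i \<omega>) *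
         exp (s * indicator {..<u} (X i \<omega>)))
       \<le> exp 1 * exp (4 * s * u) ^ n * expectation (\<lambda>\<omega>. indicator D (X j \<omega>)) * (\<Prod>i\<in>{1..<j}. 1 - c i)"
    by (simp add: f_def d_def v_def mult_ac)
qed

section \<open>The threshold rule as a stopping time\<close>

text \<open>The alternative \<open>n \<le> j\<close> forces a stop at time \<open>n\<close> and
  guarantees that \<open>LEAST\<close> has a witness; \<open>1 \<le> j\<close> excludes the index 0,
  which is outside the sample.\<close>

definition threshold_time :: "(nat \<Rightarrow> real) \<Rightarrow> 'a \<Rightarrow> nat" where
  "threshold_time c \<omega> = (LEAST j. n \<le> j \<or> 1 \<le> j \<and> X j \<omega> \<le> c j)"

lemma threshold_time_props:
  assumes "n \<ge> 1"
  shows threshold_time_in: "threshold_time c \<omega> \<in> {1..n}"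
    and threshold_time_stop: "threshold_time c \<omega> = n \<or> X (threshold_time c \<omega>) \<omega> \<le> c (threshold_time c \<omega>)"
    and threshold_time_continue: "1 \<le> i \<Longrightarrow> i < threshold_time c \<omega> \<Longrightarrow> c i < X i \<omega>"
    and threshold_time_le_iff:
      "threshold_time c \<omega> \<le> t \<longleftrightarrow> n \<le> t \<or> (\<exists>j\<in>{1..t}. X j \<omega> \<le> c j)"
proof -
  let ?P = "\<lambda>j. n \<le> j \<or> 1 \<le> j \<and> X j \<omega> \<le> c j"
  have P: "?P (threshold_time c \<omega>)"
    unfolding threshold_time_def by (rule LeastI[of ?P n]) simp
  have le: "threshold_time c \<omega> \<le> j" if "?P j" for j
    unfolding threshold_time_def using that by (rule Least_le)
  show "threshold_time c \<omega> \<in> {1..n}" using P le[of n] assms by auto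
  show "threshold_time c \<omega> = n \<or> X (threshold_time c \<omega>) \<omega> \<le> c (threshold_time c \<omega>)"
    using P le[of n] by auto
  show "c i < X i \<omega>" if "1 \<le> i" "i < threshold_time c \<omega>"
    using that le[of i] by force
  show "threshold_time c \<omega> \<le> t \<longleftrightarrow> n \<le> t \<or> (\<exists>j\<in>{1..t}. X j \<omega> \<le> c j)"
  proof
    assume "threshold_time c \<omega> \<le> t"
    then show "n \<le> t \<or> (\<exists>j\<in>{1..t}. X j \<omega> \<le> c j)"
      using P by (auto intro: bexI[of _ "threshold_time c \<omega>"])
  next
    assume "n \<le> t \<or> (\<exists>j\<in>{1..t}. X j \<omega> \<le> c j)"
    then show "threshold_time c \<omega> \<le> t"
      using le by (meson atLeastAtMost_iff order_trans)
  qed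
qed

lemma measurable_natural_filtration:
  assumes "i \<in> {1..j}"
  shows "X i \<in> borel_measurable (natural_filtration M X j)"
proof (rule measurableI)
  fix A :: "real set" assume A: "A \<in> sets borel"
  have *: "(\<Union>i\<in>{1..j}. sets (vimage_algebra (space M) (X i) borel)) \<subseteq> Pow (space M)"
    using sets.space_closed by (force simp: space_vimage_algebra)
  have "X i -` A \<inter> space M \<in> sets (vimage_algebra (space M) (X i) borel)"
    using A by (rule in_vimage_algebra)
  then show "X i -` A \<inter> space (natural_filtration M X j) \<in> sets (natural_filtration M X j)"
    unfolding natural_filtration_def using assms *
    by (auto simp: space_measure_of_conv sets_measure_of intro!: sigma_sets.Basic)
qed simp

lemma sample_stopping_time_threshold_time:
  assumes "n \<ge> 1"
  shows "sample_stopping_time M X n (threshold_time c)"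
  unfolding sample_stopping_time_def
proof
  show "threshold_time c \<in> space M \<rightarrow> {1..n}"
    using threshold_time_in[OF assms] by auto
  show "stopping_time (natural_filtration M X) (threshold_time c)"
  proof
    fix t
    have [measurable]: "X j \<in> borel_measurable (natural_filtration M X t)" if "j \<in> {1..t}" for j
      using that by (rule measurable_natural_filtration)
    show "Measurable.pred (natural_filtration M X t) (\<lambda>\<omega>. threshold_time c \<omega> \<le> t)"
      unfolding threshold_time_le_iff[OF assms] by measurable
  qed
qed

text \<open>For \<open>t < n\<close> the generators of the filtration at \<open>t\<close> are sample
  variables, hence measurable. For \<open>t \<ge> n\<close> a separate argument is required, since
  \<open>X i\<close> with \<open>i > n\<close> may fail to be measurable; there the event is the
  whole space.\<close>

lemma measurable_sample_stopping_time:
  assumes "n \<ge> 1" and T: "sample_stopping_time M X n T"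
  shows "T \<in> measurable M (count_space {1..n})"
proof -
  have T_in: "\<And>\<omega>. \<omega> \<in> space M \<Longrightarrow> T \<omega> \<in> {1..n}"
    using T by (auto simp: sample_stopping_time_def)
  have le: "Measurable.pred M (\<lambda>\<omega>. T \<omega> \<le> t)" for t
  proof (cases "n \<le> t")
    case True
    then have "T \<omega> \<le> t" if "\<omega> \<in> space M" for \<omega>
      using T_in[OF that] by simp
    then show ?thesis
      by (subst measurable_cong[where g = "\<lambda>_. True"]) auto
  next
    case False
    have gen: "(\<Union>i\<in>{1..t}. sets (vimage_algebra (space M) (X i) borel)) \<subseteq> sets M"
      using False by (intro UN_least sets_image_in_sets measurable_X) auto
    have "sets (natural_filtration M X t) \<subseteq> sets M"
      unfolding natural_filtration_def using gen
      by (subst sets_measure_of) (auto dest: sets.sets_into_space intro!: sets.sigma_sets_subset)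
    moreover have "space (natural_filtration M X t) = space M"
      by (simp add: natural_filtration_def space_measure_of_conv)
    moreover have "Measurable.pred (natural_filtration M X t) (\<lambda>\<omega>. T \<omega> \<le> t)"
      using T by (auto simp: sample_stopping_time_def dest: stopping_timeD)
    ultimately show ?thesis
      by (auto simp: pred_def)
  qed
  have "T -` {t} \<inter> space M \<in> sets M" if "t \<in> {1..n}" for t
  proof -
    have "T -` {t} \<inter> space M = {\<omega>\<in>space M. T \<omega> \<le> t \<and> \<not> T \<omega> \<le> t - 1}"
      using that by auto
    also have "\<dots> \<in> sets M"
      using le[of t] le[of "t - 1"] by measurable
    finally show ?thesis .
  qed
  then show ?thesis
    using T_in by (subst measurable_count_space_eq2) auto
qed

section \<open>A bounded rank moment for the threshold rule\<close>

text \<open>The first summand of the bound accounts for stopping before time \<open>n\<close>, the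
  second for the forced stop at \<open>n\<close>, where the rank is at most \<open>n\<close> but the
  probability of arrival is of order \<open>n\<close> to the power \<open>- Suc q\<close>.\<close>

lemma expected_rank_power_threshold_time_le:
  fixes p :: real
  assumes "n \<ge> 1" "0 < p" "p \<le> real q"
  shows "expected_rank_power M X n p
      (threshold_time (\<lambda>i. real (Suc q) / (real n - real i + 2 * real (Suc q))))
    \<le> fact q * exp 1 * exp 1 * exp (4 * real (Suc q)) * real (Suc q) +
       exp 1 * (2 * real (Suc q)) ^ Suc q"
proof -
  \<comment> \<open>The exponent is one more than \<open>q\<close>: the factor
    \<open>s j ^ Suc q\<close> for reaching \<open>j\<close> cancels \<open>s j ^ q\<close> in the
    denominator of \<open>K j\<close> and leaves one \<open>s j\<close>.\<close>
  define a where "a = real (Suc q)"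
  \<comment> \<open>The offset \<open>2 * a\<close> keeps all thresholds at most 1/2 and gives
    \<open>y n = 2 * a\<close> and \<open>y 1 \<ge> n\<close>.\<close>
  define y where "y = (\<lambda>i. real n - real i + 2 * a)"
  define c where "c = (\<lambda>i. a / y i)"
  \<comment> \<open>With this rate \<open>s j * c j = a / y 1\<close> for every \<open>j\<close>, so
    the \<open>n\<close> exponential factors together cost at most
    \<open>exp (4 * a)\<close>.\<close>
  define s where "s = (\<lambda>i. y i / y 1)"
  define K where "K = (\<lambda>j. fact q / s j ^ q * exp 1 :: real)"
  define G :: "nat \<Rightarrow> 'a \<Rightarrow> real" where
    "G = (\<lambda>j \<omega>. \<Prod>i\<in>{1..n}. indicator (continuation_region c j {..c j} i) (X i \<omega>) *
       exp (s j * indicator {..<c j} (X i \<omega>)))"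
  \<comment> \<open>This is the indicator of reaching time \<open>n\<close>. The trivial factor
    \<open>exp (0 * _)\<close> brings it into the form of the general continuation estimate.\<close>
  define H :: "'a \<Rightarrow> real" where
    "H = (\<lambda>\<omega>. \<Prod>i\<in>{1..n}. indicator (continuation_region c n UNIV i) (X i \<omega>) *
       exp (0 * indicator {..<0} (X i \<omega>)))"
  have a: "a \<ge> 1" by (simp add: a_def)
  have y_ge: "2 * a \<le> y i" "y i \<le> y 1" if "i \<in> {1..n}" for i
    using that by (auto simp: y_def)
  have y1: "real n \<le> y 1" "0 < y 1" "1 \<le> y 1"
    using a \<open>n \<ge> 1\<close> by (simp_all add: y_def)
  have c: "0 \<le> c i \<and> c i \<le> 1 / 2" if "i \<in> {1..n}" for i
    using y_ge[OF that] a by (simp add: c_def field_simps)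
  have s: "0 < s i" "s i \<le> 1" if "i \<in> {1..n}" for i
    using y_ge[OF that] a y1 by (simp_all add: s_def)
  have K0: "0 \<le> K i" if "i \<in> {1..n}" for i
    using s[OF that] by (simp add: K_def)
  have G0: "0 \<le> G j \<omega>" and H0: "0 \<le> H \<omega>" for j \<omega>
    by (auto simp: G_def H_def intro!: prod_nonneg)
  have prod_le: "(\<Prod>i\<in>{1..<j}. 1 - c i) \<le> s j ^ Suc q" if "j \<in> {1..n}" for j
    using prod_one_minus_divide_le_power[of "2 * a" "Suc q" j n] that a
    by (simp add: c_def s_def y_def a_def)

  \<comment> \<open>On each path only one term is used, the summand at the stopping time or
    \<open>H\<close> if that time is \<open>n\<close>; all others are nonnegative.\<close>
  have pointwise: "real (sample_rank n (\<lambda>j. X j \<omega>) (threshold_time c \<omega>)) powr p \<le>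
      (\<Sum>j\<in>{1..<n}. K j * G j \<omega>) + real n ^ q * H \<omega>" for \<omega>
  proof -
    define T where "T = threshold_time c \<omega>"
    define R where "R = real (sample_rank n (\<lambda>j. X j \<omega>) T)"
    have T: "T \<in> {1..n}" unfolding T_def by (rule threshold_time_in[OF \<open>n \<ge> 1\<close>])
    have before: "c i < X i \<omega>" if "1 \<le> i" "i < T" for i
      using threshold_time_continue[OF \<open>n \<ge> 1\<close>] that by (simp add: T_def)
    have R: "1 \<le> R" "R \<le> real n"
      using sample_rank_bounds[OF T] by (simp_all add: R_def)
    have "R powr p \<le> R powr real q" using R assms by (intro powr_mono) auto
    also have "\<dots> = R ^ q" using R by (simp add: powr_realpow)
    also have "\<dots> \<le> (\<Sum>j\<in>{1..<n}. K j * G j \<omega>) + real n ^ q * H \<omega>"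
    proof (cases "T = n")
      case True
      have "H \<omega> = 1"
        unfolding H_def using before True
        by (intro prod.neutral) (auto simp: continuation_region_def)
      moreover have "R ^ q \<le> real n ^ q" using R by (intro power_mono) auto
      moreover have "0 \<le> (\<Sum>j\<in>{1..<n}. K j * G j \<omega>)"
        using K0 G0 by (intro sum_nonneg mult_nonneg_nonneg) auto
      ultimately show ?thesis by simp
    next
      case False
      define N where "N = real (card {i\<in>{1..n}. X i \<omega> < c T})"
      have XT: "X T \<omega> \<le> c T"
        using threshold_time_stop[OF \<open>n \<ge> 1\<close>, of c \<omega>] False by (simp add: T_def)
      have "G T \<omega> = (\<Prod>i\<in>{1..n}. exp (s T * indicator {..<c T} (X i \<omega>)))"
        unfolding G_def using before XT
        by (intro prod.cong) (auto simp: continuation_region_def)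
      also have "\<dots> = exp (s T * N)"
        unfolding N_def real_card_less_eq_sum_indicator by (simp only: exp_sum sum_distrib_left finite_atLeastAtMost)
      finally have G: "G T \<omega> = exp (s T * N)" .
      have "card {i\<in>{1..n}. X i \<omega> < X T \<omega>} \<le> card {i\<in>{1..n}. X i \<omega> < c T}"
        using XT by (intro card_mono) auto
      then have "R \<le> 1 + N"
        by (simp add: R_def N_def sample_rank_eq_Suc_card[OF T])
      have "R ^ q \<le> fact q / s T ^ q * exp (s T * R)"
        using R s[OF T] by (intro power_le_fact_mult_exp) auto
      \<comment> \<open>The stopped observation itself contributes 1 to the rank, hence at most
        \<open>s T \<le> 1\<close> to the exponent; this is the factor \<open>exp 1\<close> in
        \<open>K\<close>.\<close>
      also have "\<dots> \<le> fact q / s T ^ q * exp (1 + s T * N)"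
      proof -
        have "s T * R \<le> s T * (1 + N)"
          using \<open>R \<le> 1 + N\<close> s[OF T] by (intro mult_left_mono) auto
        also have "\<dots> \<le> 1 + s T * N"
          using s[OF T] by (simp add: distrib_left)
        finally show ?thesis
          using s[OF T] by (intro mult_left_mono) auto
      qed
      also have "\<dots> = K T * G T \<omega>"
        by (simp add: K_def G exp_add)
      also have "\<dots> \<le> (\<Sum>j\<in>{1..<n}. K j * G j \<omega>)"
        using T False K0 G0 by (intro member_le_sum[of T _ "\<lambda>j. K j * G j \<omega>"]) auto
      finally show ?thesis using H0 by (simp add: add_increasing2)
    qed
    finally show ?thesis by (simp add: R_def T_def)
  qed

  have intG: "integrable M (G j)" if "j \<in> {1..n}" for j
    unfolding G_def using c[OF that] s[OF that]
    by (intro integrable_continuation that c) auto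
  have intH: "integrable M H"
    unfolding H_def using \<open>n \<ge> 1\<close>
    by (intro integrable_continuation c) auto
  \<comment> \<open>One \<open>exp 1\<close> comes from \<open>K j\<close>, the other from bounding
    the exponential weight at coordinate \<open>j\<close>.\<close>
  have EG: "K j * expectation (G j) \<le> fact q * exp 1 * exp 1 * exp (4 * a) * a / y 1" if j: "j \<in> {1..n}" for j
  proof -
    have "expectation (G j) \<le>
        exp 1 * exp (4 * s j * c j) ^ n * expectation (\<lambda>\<omega>. indicator {..c j} (X j \<omega>)) * (\<Prod>i\<in>{1..<j}. 1 - c i)"
      unfolding G_def using c[OF j] s[OF j]
      by (intro expectation_continuation_le j c) auto
    also have "expectation (\<lambda>\<omega>. indicator {..c j} (X j \<omega>)) = c j"
      using c[OF j] by (intro expectation_atMost j) auto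
    also have "exp (4 * s j * c j) ^ n = exp (4 * a * (real n / y 1))"
      using y_ge[OF j] a by (simp add: s_def c_def flip: exp_of_nat_mult)
    also have "exp 1 * exp (4 * a * (real n / y 1)) * c j * (\<Prod>i\<in>{1..<j}. 1 - c i) \<le>
        exp 1 * exp (4 * a * 1) * c j * s j ^ Suc q"
    proof (rule mult_mono)
      have "real n / y 1 \<le> 1" using y1 by simp
      then have "exp (4 * a * (real n / y 1)) \<le> exp (4 * a * 1)"
        using a by (subst exp_le_cancel_iff) (intro mult_left_mono; simp)
      then show "exp 1 * exp (4 * a * (real n / y 1)) * c j \<le> exp 1 * exp (4 * a * 1) * c j"
        using c[OF j] by (intro mult_right_mono mult_left_mono) auto
      show "0 \<le> (\<Prod>i\<in>{1..<j}. 1 - c i)"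
      proof (rule prod_nonneg)
        fix i assume "i \<in> {1..<j}"
        then show "0 \<le> 1 - c i" using c[of i] j by simp
      qed
    qed (use c[OF j] prod_le[OF j] in auto)
    finally have "K j * expectation (G j) \<le> K j * (exp 1 * exp (4 * a * 1) * c j * s j ^ Suc q)"
      using K0[OF j] by (intro mult_left_mono)
    also have "\<dots> = fact q * exp 1 * exp 1 * exp (4 * a) * (c j * s j)"
      using s[OF j] by (simp add: K_def)
    also have "c j * s j = a / y 1"
      using y_ge[OF j] a by (simp add: c_def s_def)
    finally show ?thesis by simp
  qed
  have EH: "real n ^ q * expectation H \<le> exp 1 * (2 * a) ^ Suc q"
  proof -
    have n: "n \<in> {1..n}" using \<open>n \<ge> 1\<close> by simp
    have "expectation H \<le>
        exp 1 * exp (4 * 0 * 0) ^ n * expectation (\<lambda>\<omega>. indicator UNIV (X n \<omega>)) * (\<Prod>i\<in>{1..<n}. 1 - c i)"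
      unfolding H_def by (intro expectation_continuation_le n c) auto
    also have "\<dots> = exp 1 * (\<Prod>i\<in>{1..<n}. 1 - c i)"
      by (simp add: prob_space)
    also have "\<dots> \<le> exp 1 * s n ^ Suc q"
      by (intro mult_left_mono prod_le n) auto
    \<comment> \<open>Raising \<open>n ^ q\<close> to \<open>y 1 ^ Suc q\<close> is affordable,
      because \<open>s n = 2 * a / y 1\<close> enters with the same exponent and cancels it.\<close>
    finally have "real n ^ q * expectation H \<le> y 1 ^ Suc q * (exp 1 * s n ^ Suc q)"
      using y1 s[OF n] power_mono[of "real n" "y 1" q] mult_mono[of 1 "y 1" "real n ^ q" "y 1 ^ q"]
      by (intro mult_mono) (auto intro!: integral_nonneg_AE simp: H0)
    also have "\<dots> = exp 1 * (2 * a) ^ Suc q"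
      using y1 by (simp add: s_def y_def power_divide)
    finally show ?thesis .
  qed

  have T: "threshold_time c \<in> measurable M (count_space {1..n})"
    using \<open>n \<ge> 1\<close> by (intro measurable_sample_stopping_time sample_stopping_time_threshold_time)
  have intS: "integrable M (\<lambda>\<omega>. \<Sum>j\<in>{1..<n}. K j * G j \<omega>)"
    by (intro Bochner_Integration.integrable_sum integrable_mult_right intG) auto
  have "expected_rank_power M X n p (threshold_time c) \<le>
      expectation (\<lambda>\<omega>. (\<Sum>j\<in>{1..<n}. K j * G j \<omega>) + real n ^ q * H \<omega>)"
    unfolding expected_rank_power_def
    by (intro integral_mono integrable_rank_power T \<open>0 < p\<close> Bochner_Integration.integrable_add
        intS integrable_mult_right intH pointwise)
  also have "\<dots> = (\<Sum>j\<in>{1..<n}. K j * expectation (G j)) + real n ^ q * expectation H"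
    using intS intH intG by (simp add: Bochner_Integration.integral_sum)
  also have "\<dots> \<le> (\<Sum>j\<in>{1..<n}. fact q * exp 1 * exp 1 * exp (4 * a) * a / y 1) + exp 1 * (2 * a) ^ Suc q"
    by (intro add_mono sum_mono EG EH) auto
  \<comment> \<open>The bound is the same for every stopping time, so \<open>n - 1\<close> terms of
    size proportional to \<open>1 / y 1\<close> add up to a constant.\<close>
  also have "(\<Sum>j\<in>{1..<n}. fact q * exp 1 * exp 1 * exp (4 * a) * a / y 1) =
      fact q * exp 1 * exp 1 * exp (4 * a) * a * (real (n - 1) / y 1)"
    by simp
  also have "\<dots> \<le> fact q * exp 1 * exp 1 * exp (4 * a) * a"
    using y1 a by (intro mult_left_le) auto
  finally show ?thesis
    by (simp add: c_def y_def a_def)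
qed

end

section \<open>Passage from finite samples to upper limits\<close>

lemma limsup_less_infinityI:
  fixes f :: "nat \<Rightarrow> real"
  assumes "eventually (\<lambda>n. f n \<le> C) sequentially"
  shows "limsup (\<lambda>n. ereal (f n)) < \<infinity>"
proof -
  have "limsup (\<lambda>n. ereal (f n)) \<le> ereal C"
    using assms by (intro Limsup_bounded) (auto elim: eventually_mono)
  then show ?thesis by (rule le_less_trans) simp
qed

lemma limsup_less_infinityE:
  fixes f :: "nat \<Rightarrow> real"
  assumes "limsup (\<lambda>n. ereal (f n)) < \<infinity>"
  obtains C where "eventually (\<lambda>n. f n \<le> C) sequentially"
proof -
  obtain k :: nat where "limsup (\<lambda>n. ereal (f n)) < ereal (real k)"
    using assms less_PInf_Ex_of_nat by auto
  then have "eventually (\<lambda>n. f n \<le> real k) sequentially"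
    by (auto dest!: Limsup_lessD elim: eventually_mono)
  then show ?thesis by (rule that)
qed

theorem proposition1:
  fixes p :: real
    and M :: "nat \<Rightarrow> 'a measure"
    and X :: "nat \<Rightarrow> nat \<Rightarrow> 'a \<Rightarrow> real"
  assumes "p > 0"
    and "\<And>n. n \<ge> 1 \<Longrightarrow> iid_uniform_sample (M n) (X n) n"
  shows "(\<forall>\<sigma> :: nat \<Rightarrow> 'a \<Rightarrow> nat.
            (\<forall>n\<ge>1. \<sigma> n \<in> measurable (M n) (count_space {1..n})) \<longrightarrow>
            limsup (\<lambda>n. ereal (expected_rank_power (M n) (X n) n p (\<sigma> n))) < \<infinity> \<longrightarrow>
            limsup (\<lambda>n. ereal (real n powr p * expected_value_power (M n) (X n) p (\<sigma> n))) < \<infinity>)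
       \<and> (\<forall>\<tau> :: nat \<Rightarrow> 'a \<Rightarrow> nat.
            (\<forall>n\<ge>1. is_arg_min (expected_rank_power (M n) (X n) n p)
                              (sample_stopping_time (M n) (X n) n) (\<tau> n)) \<longrightarrow>
            limsup (\<lambda>n. ereal (real n powr p * expected_value_power (M n) (X n) p (\<tau> n))) < \<infinity>)"
proof -
  have sample: "uniform_sample (M n) (X n) n" if "n \<ge> 1" for n
    using assms(2)[OF that]
    by (simp add: uniform_sample_def uniform_sample_axioms_def iid_uniform_sample_def)
  define S where "S = (\<Sum>m. (real m + 1) powr p * exp ((real m + 1) / 4 - real m / 2))"
  have main: "limsup (\<lambda>n. ereal (real n powr p * expected_value_power (M n) (X n) p (\<sigma> n))) < \<infinity>"
    if meas: "\<And>n. n \<ge> 1 \<Longrightarrow> \<sigma> n \<in> measurable (M n) (count_space {1..n})"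
      and bounded: "limsup (\<lambda>n. ereal (expected_rank_power (M n) (X n) n p (\<sigma> n))) < \<infinity>"
    for \<sigma> :: "nat \<Rightarrow> 'a \<Rightarrow> nat"
  proof -
    obtain C where "eventually (\<lambda>n. expected_rank_power (M n) (X n) n p (\<sigma> n) \<le> C) sequentially"
      using limsup_less_infinityE[OF bounded] by blast
    then have "eventually (\<lambda>n. real n powr p * expected_value_power (M n) (X n) p (\<sigma> n) \<le>
        4 powr p * C + S) sequentially"
      using eventually_ge_at_top[of 1]
    proof eventually_elim
      case (elim n)
      have "real n powr p * expected_value_power (M n) (X n) p (\<sigma> n) \<le>
          4 powr p * expected_rank_power (M n) (X n) n p (\<sigma> n) + S"
        unfolding S_def using elim assms(1)
        by (intro uniform_sample.expected_value_power_le sample meas)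
      also have "\<dots> \<le> 4 powr p * C + S"
        using elim by (intro add_right_mono mult_left_mono) auto
      finally show ?case .
    qed
    then show ?thesis by (rule limsup_less_infinityI)
  qed
  have optimal: "limsup (\<lambda>n. ereal (real n powr p * expected_value_power (M n) (X n) p (\<tau> n))) < \<infinity>"
    if min: "\<And>n. n \<ge> 1 \<Longrightarrow> is_arg_min (expected_rank_power (M n) (X n) n p)
               (sample_stopping_time (M n) (X n) n) (\<tau> n)"
    for \<tau> :: "nat \<Rightarrow> 'a \<Rightarrow> nat"
  \<comment> \<open>An optimal stopping time is a measurable random index, so the first implication
    applies once its rank moment is bounded.\<close>
  proof (rule main)
    define q where "q = nat \<lceil>p\<rceil>"
    have q: "p \<le> real q" unfolding q_def by (rule real_nat_ceiling_ge)
    define C where "C = fact q * exp 1 * exp 1 * exp (4 * real (Suc q)) * real (Suc q) +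
       exp 1 * (2 * real (Suc q)) ^ Suc q"
    have "expected_rank_power (M n) (X n) n p (\<tau> n) \<le> C" if "n \<ge> 1" for n
    proof -
      interpret uniform_sample "M n" "X n" n using that by (rule sample)
      define T where "T = threshold_time (\<lambda>i. real (Suc q) / (real n - real i + 2 * real (Suc q)))"
      have "sample_stopping_time (M n) (X n) n T"
        unfolding T_def by (rule sample_stopping_time_threshold_time[OF that])
      \<comment> \<open>Optimality means that no stopping time has a strictly smaller rank moment,
        so the explicit threshold rule bounds the optimum from above.\<close>
      then have "expected_rank_power (M n) (X n) n p (\<tau> n) \<le> expected_rank_power (M n) (X n) n p T"
        using min[OF that] by (auto simp: is_arg_min_def not_less)
      also have "\<dots> \<le> C"
        unfolding C_def T_def by (rule expected_rank_power_threshold_time_le[OF that assms(1) q])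
      finally show ?thesis .
    qed
    then show "limsup (\<lambda>n. ereal (expected_rank_power (M n) (X n) n p (\<tau> n))) < \<infinity>"
      by (intro limsup_less_infinityI[of _ C] eventually_sequentiallyI[of 1])
    show "\<tau> n \<in> measurable (M n) (count_space {1..n})" if "n \<ge> 1" for n
      using uniform_sample.measurable_sample_stopping_time[OF sample[OF that] that] min[OF that]
      by (simp add: is_arg_min_def)
  qed
  show ?thesis
  proof (intro conjI allI impI)
    fix \<sigma> :: "nat \<Rightarrow> 'a \<Rightarrow> nat"
    assume "\<forall>n\<ge>1. \<sigma> n \<in> measurable (M n) (count_space {1..n})"
      and "limsup (\<lambda>n. ereal (expected_rank_power (M n) (X n) n p (\<sigma> n))) < \<infinity>"
    then show "limsup (\<lambda>n. ereal (real n powr p * expected_value_power (M n) (X n) p (\<sigma> n))) < \<infinity>"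
      by (intro main) blast+
  next
    fix \<tau> :: "nat \<Rightarrow> 'a \<Rightarrow> nat"
    assume "\<forall>n\<ge>1. is_arg_min (expected_rank_power (M n) (X n) n p)
        (sample_stopping_time (M n) (X n) n) (\<tau> n)"
    then show "limsup (\<lambda>n. ereal (real n powr p * expected_value_power (M n) (X n) p (\<tau> n))) < \<infinity>"
      by (intro optimal) blast
  qed
qed

end
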